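(* Suppose that $f$ and $g$ are convex, closed and proper, that for some $0<m\le L<\infty$ we have $f\in S_p(m,L)$ and $g\in S_q(0,\infty)$, that $A$ is invertible, and that $B$ has full column rank. The worst-case convergence rate of over-relaxed ADMM, when run with step size $\rho=(\hat m\hat L)^{1/2}\kappa^{\epsilon}$ and over-relaxation parameter $\alpha$, is lower-bounded by $$1-\frac{2\alpha}{1+\kappa^{0.5+|\epsilon|}}.$$
   Context: $\overline{\mathbb R}=\mathbb R\cup\{+\infty\}$; norms are Euclidean. For $0<m\le L<\infty$, $S_d(m,L)$ is the set of differentiable convex functions $f\colon\mathbb R^d\to\overline{\mathbb R}$ that are strongly convex with parameter $m$, i.e. $f(x)\ge f(y)+\nabla f(y)^\top(x-y)+\frac m2\|x-y\|^2$ for all $x,y\in\mathbb R^d$, and whose gradients are Lipschitz continuous with parameter $L$. $S_d(0,\infty)$ is the set of convex functions $\mathbb R^d\to\overline{\mathbb R}$. Closed means that the sublevel sets are closed; proper means never equal to $-\infty$ and not identically $+\infty$. The problem is to minimize $f(x)+g(z)$ subject to $Ax+Bz=c$, with variables $x\in\mathbb R^p$, $z\in\mathbb R^q$ and constants $A\in\mathbb R^{r\times p}$, $B\in\mathbb R^{r\times q}$, $c\in\mathbb R^r$. Over-relaxed ADMM with step size $\rho>0$ and over-relaxation parameter $\alpha$: initialize $x_0,z_0,u_0$ and for $k\ge0$ set $$x_{k+1}=\operatorname{argmin}_x f(x)+\tfrac\rho2\|Ax+Bz_k-c+u_k\|^2,$$ $$z_{k+1}=\operatorname{argmin}_z g(z)+\tfrac\rho2\|\alpha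 Ax_{k+1}-(1-\alpha)Bz_k+Bz-\alpha c+u_k\|^2,$$ $$u_{k+1}=u_k+\alpha Ax_{k+1}-(1-\alpha)Bz_k+Bz_{k+1}-\alpha c.$$ With $\sigma_1(A)$ and $\sigma_p(A)$ the largest and smallest singular values of $A$: $\kappa_f=L/m$, $\kappa_A=\sigma_1(A)/\sigma_p(A)$, $\kappa=\kappa_f\kappa_A^2$, $\hat m=m/\sigma_1^2(A)$, $\hat L=L/\sigma_p^2(A)$. The exponent $\epsilon$ in the step size is a real number. The term "worst-case convergence rate" is used informally in the source, without a formal definition: "rate" refers to the factor $\tau$ in linear convergence of the iterates to a fixed point (error proportional to $\tau^k$ after $k$ iterations), and "worst-case" refers to the choice of problem satisfying the stated assumptions and of the initialization, for the given $\kappa$, $\epsilon$ and $\alpha$.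
   Formalization: The over-relaxation parameter α is assumed positive; for α = 0 the iterates become stationary after finitely many steps, so the rate is 0 while the claimed bound is 1, and for α < 0 with κ = 1, ε = 0 the growth factor 1+|α|/2 is below the claimed 1+|α|. *)

theory Defs
  imports "HOL-Analysis.Analysis"
begin

(* The value set R \<union> {+\<infinity>} is represented by ereal; -\<infinity> is excluded explicitly. *)

definition ereal_convex :: "('a::real_vector \<Rightarrow> ereal) \<Rightarrow> bool" where
  "ereal_convex f \<longleftrightarrow>
     (\<forall>x. f x \<noteq> -\<infinity>) \<and>
     (\<forall>x y. \<forall>t\<in>{0..1::real}.
        f ((1 - t) *\<^sub>R x + t *\<^sub>R y) \<le> ereal (1 - t) * f x + ereal t * f y)"

definition closed_fun :: "('a::topological_space \<Rightarrow> ereal) \<Rightarrow> bool" where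
  "closed_fun f \<longleftrightarrow> (\<forall>a::real. closed {x. f x \<le> ereal a})"

definition proper_fun :: "('a \<Rightarrow> ereal) \<Rightarrow> bool" where
  "proper_fun f \<longleftrightarrow> (\<forall>x. f x \<noteq> -\<infinity>) \<and> (\<exists>x. f x \<noteq> \<infinity>)"

(* S_d(m,L) for 0 < m \<le> L < \<infinity>. Differentiability on all of the space forces finite values;
   G is the gradient. *)
definition S_smooth :: "real \<Rightarrow> real \<Rightarrow> ('a::euclidean_space \<Rightarrow> ereal) set" where
  "S_smooth m L = {f. ereal_convex f \<and> (\<forall>x. \<bar>f x\<bar> \<noteq> \<infinity>) \<and>
     (\<exists>G. (\<forall>x. GDERIV (\<lambda>y. real_of_ereal (f y)) x :> G x) \<and>
          (\<forall>x y. f x \<ge> f y + ereal (G y \<bullet> (x - y) + m / 2 * (norm (x - y))\<^sup>2)) \<and>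
          lipschitz_on L UNIV G)}"

(* S_d(0,\<infinity>) *)
definition S_convex :: "('a::euclidean_space \<Rightarrow> ereal) set" where
  "S_convex = {g. ereal_convex g}"

(* Square roots of the eigenvalues of the Gram matrix, one for each column dimension
   up to multiplicity, so that Min is the p-th singular value of a matrix with p columns. *)
definition singular_values :: "real^'p^'r \<Rightarrow> real set" where
  "singular_values A =
     {s. 0 \<le> s \<and> (\<exists>v. v \<noteq> 0 \<and> (transpose A ** A) *v v = (s\<^sup>2) *\<^sub>R v)}"

definition sigma_max :: "real^'p^'r \<Rightarrow> real" where
  "sigma_max A = Max (singular_values A)"

definition sigma_min :: "real^'p^'r \<Rightarrow> real" where
  "sigma_min A = Min (singular_values A)"

definition cond_total :: "real \<Rightarrow> real \<Rightarrow> real^'p^'r \<Rightarrow> real" where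
  "cond_total m L A = (L / m) * (sigma_max A / sigma_min A)\<^sup>2"

definition m_hat :: "real \<Rightarrow> real^'p^'r \<Rightarrow> real" where
  "m_hat m A = m / (sigma_max A)\<^sup>2"

definition L_hat :: "real \<Rightarrow> real^'p^'r \<Rightarrow> real" where
  "L_hat L A = L / (sigma_min A)\<^sup>2"

definition step_size :: "real \<Rightarrow> real \<Rightarrow> real^'p^'r \<Rightarrow> real \<Rightarrow> real" where
  "step_size m L A \<epsilon> = (m_hat m A * L_hat L A) powr (1/2) * cond_total m L A powr \<epsilon>"

fun admm_step ::
  "(real^'p \<Rightarrow> ereal) \<Rightarrow> (real^'q \<Rightarrow> ereal) \<Rightarrow> real^'p^'r \<Rightarrow> real^'q^'r \<Rightarrow> real^'r \<Rightarrow>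
   real \<Rightarrow> real \<Rightarrow> (real^'p) \<times> (real^'q) \<times> (real^'r) \<Rightarrow> (real^'p) \<times> (real^'q) \<times> (real^'r) \<Rightarrow> bool"
where
  "admm_step f g A B c \<rho> \<alpha> (x, z, u) (x', z', u') \<longleftrightarrow>
     is_arg_min (\<lambda>\<xi>. f \<xi> + ereal (\<rho> / 2 * (norm (A *v \<xi> + B *v z - c + u))\<^sup>2)) (\<lambda>_. True) x' \<and>
     is_arg_min (\<lambda>\<zeta>. g \<zeta> + ereal (\<rho> / 2 * (norm (\<alpha> *\<^sub>R (A *v x') - (1 - \<alpha>) *\<^sub>R (B *v z)
                          + B *v \<zeta> - \<alpha> *\<^sub>R c + u))\<^sup>2)) (\<lambda>_. True) z' \<and>
     u' = u + \<alpha> *\<^sub>R (A *v x') - (1 - \<alpha>) *\<^sub>R (B *v z) + B *v z' - \<alpha> *\<^sub>R c"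

(* The initialization is w 0. *)
definition admm_run ::
  "(real^'p \<Rightarrow> ereal) \<Rightarrow> (real^'q \<Rightarrow> ereal) \<Rightarrow> real^'p^'r \<Rightarrow> real^'q^'r \<Rightarrow> real^'r \<Rightarrow>
   real \<Rightarrow> real \<Rightarrow> (nat \<Rightarrow> (real^'p) \<times> (real^'q) \<times> (real^'r)) \<Rightarrow> bool" where
  "admm_run f g A B c \<rho> \<alpha> w \<longleftrightarrow> (\<forall>k. admm_step f g A B c \<rho> \<alpha> (w k) (w (Suc k)))"

(* Infimum of the factors \<tau> for which the error to some fixed point is bounded by C \<tau>^k.
   The constant C may depend on the problem and on the initialization. *)
definition admm_rate ::
  "(real^'p \<Rightarrow> ereal) \<Rightarrow> (real^'q \<Rightarrow> ereal) \<Rightarrow> real^'p^'r \<Rightarrow> real^'q^'r \<Rightarrow> real^'r \<Rightarrow>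
   real \<Rightarrow> real \<Rightarrow> (nat \<Rightarrow> (real^'p) \<times> (real^'q) \<times> (real^'r)) \<Rightarrow> ereal" where
  "admm_rate f g A B c \<rho> \<alpha> w =
     Inf {ereal \<tau> | \<tau>. 0 \<le> \<tau> \<and>
       (\<exists>w'. admm_step f g A B c \<rho> \<alpha> w' w' \<and> (\<exists>C. \<forall>k. norm (w k - w') \<le> C * \<tau> ^ k))}"

definition admm_assumptions ::
  "real \<Rightarrow> real \<Rightarrow> (real^'p \<Rightarrow> ereal) \<Rightarrow> (real^'q \<Rightarrow> ereal) \<Rightarrow> real^'p^'r \<Rightarrow> real^'q^'r \<Rightarrow> bool" where
  "admm_assumptions m L f g A B \<longleftrightarrow>
     0 < m \<and> m \<le> L \<and>
     ereal_convex f \<and> closed_fun f \<and> proper_fun f \<and>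
     ereal_convex g \<and> closed_fun g \<and> proper_fun g \<and>
     f \<in> S_smooth m L \<and> g \<in> S_convex \<and>
     invertible A \<and> rank B = CARD('q)"

(* Supremum over all problems (f, g, A, B, c and the parameters m, L) in dimensions p, q, r
   with condition number \<kappa>, and over all initializations. *)
definition worst_case_rate ::
  "'p::finite itself \<Rightarrow> 'q::finite itself \<Rightarrow> 'r::finite itself \<Rightarrow> real \<Rightarrow> real \<Rightarrow> real \<Rightarrow> ereal" where
  "worst_case_rate _ _ _ \<kappa> \<epsilon> \<alpha> =
     Sup {admm_rate f g A B c (step_size m L A \<epsilon>) \<alpha> w |
            m L (f :: real^'p \<Rightarrow> ereal) (g :: real^'q \<Rightarrow> ereal) (A :: real^'p^'r) (B :: real^'q^'r) c w.
            admm_assumptions m L f g A B \<and> cond_total m L A = \<kappa> \<and>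
            admm_run f g A B c (step_size m L A \<epsilon>) \<alpha> w}"

end

theory Submission
  imports Defs
begin

text \<open>
  The factor \<open>1 - \<alpha> / (1 + \<kappa> powr (0.5 + \<bar>\<epsilon>\<bar>))\<close>, which is already at least the claimed bound, is
  attained by isotropic quadratics with \<open>m = 1\<close>, \<open>L = \<kappa>\<close>, \<open>c = 0\<close> and \<open>A\<close>, \<open>B\<close> isometries.
  With \<open>f x = \<beta>/2 \<parallel>x\<parallel>\<^sup>2\<close> the \<open>x\<close>-update multiplies by \<open>-\<rho>/(\<beta> + \<rho>)\<close>. For \<open>\<epsilon> \<ge> 0\<close> take \<open>\<beta> = m\<close> and
  \<open>g = 0\<close>: the multiplier \<open>u\<close> vanishes and \<open>z\<close> is scaled by \<open>1 - \<alpha> m/(m + \<rho>)\<close>. For \<open>\<epsilon> < 0\<close> take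
  \<open>\<beta> = L\<close> and \<open>g\<close> the indicator function of the origin: \<open>z\<close> vanishes and \<open>u\<close> is scaled by
  \<open>1 - \<alpha> \<rho>/(L + \<rho>)\<close>.
\<close>

section \<open>Isometric matrices and their singular values\<close>

text \<open>Column \<open>j\<close> is the unit vector at index \<open>h j\<close>, so an injection
  of index types becomes an isometric embedding. This stands in for \<open>mat 1\<close>, whose rows
  and columns have the same index type.\<close>

definition inj_matrix :: "('n \<Rightarrow> 'm) \<Rightarrow> real^'n^'m" where
  "inj_matrix h = (\<chi> i j. of_bool (i = h j))"

lemma transpose_inj_matrix_mult:
  fixes h :: "'n::finite \<Rightarrow> 'm::finite"
  assumes "inj h"
  shows "transpose (inj_matrix h) ** inj_matrix h = mat 1"
  using assms
  by (auto simp: inj_matrix_def matrix_matrix_mult_def transpose_def mat_def vec_eq_iff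
      of_bool_def if_distrib[where f = "\<lambda>x. x * _"] inj_eq cong: if_cong)

lemma inj_matrix_mult_transpose:
  fixes h :: "'n::finite \<Rightarrow> 'm::finite"
  assumes "bij h"
  shows "inj_matrix h ** transpose (inj_matrix h) = mat 1"
proof -
  have "i = h j \<longleftrightarrow> j = inv h i" for i j
    using assms by (metis bij_inv_eq_iff)
  then show ?thesis
    using assms bij_is_surj[OF assms]
    by (auto simp: inj_matrix_def matrix_matrix_mult_def transpose_def mat_def vec_eq_iff
        of_bool_def if_distrib[where f = "\<lambda>x. x * _"] surj_f_inv_f cong: if_cong)
      (metis surj_f_inv_f)
qed

lemma norm_isometry_mult:
  fixes A :: "real^'n::finite^'m::finite"
  assumes "transpose A ** A = mat 1"
  shows "norm (A *v x) = norm x"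
proof -
  have "(A *v x) \<bullet> (A *v x) = (transpose A *v (A *v x)) \<bullet> x"
    by (simp add: dot_lmul_matrix transpose_matrix_vector)
  also have "\<dots> = x \<bullet> x"
    using assms by (simp add: matrix_vector_mul_assoc)
  finally show ?thesis
    by (simp add: norm_eq_sqrt_inner)
qed

lemma rank_isometry:
  fixes A :: "real^'n::finite^'m::finite"
  assumes "transpose A ** A = mat 1"
  shows "rank A = CARD('n)"
proof -
  have "inj ((*v) A)"
    using assms by (metis injI matrix_vector_mul_assoc matrix_vector_mul_lid)
  then show ?thesis
    by (simp add: full_rank_injective)
qed

text \<open>The Gram matrix is the identity, with 1 as its only eigenvalue. Hence
  \<open>\<kappa> = L / m\<close>, and \<open>m = 1\<close>, \<open>L = \<kappa>\<close> realize any
  prescribed \<open>\<kappa> \<ge> 1\<close>.\<close>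

lemma singular_values_isometry:
  fixes A :: "real^'n::finite^'m::finite"
  assumes "transpose A ** A = mat 1"
  shows "singular_values A = {1}"
proof -
  have "v = s\<^sup>2 *\<^sub>R v \<longleftrightarrow> s = 1" if "0 \<le> s" "v \<noteq> 0" for s and v :: "real^'n"
  proof -
    have "v = s\<^sup>2 *\<^sub>R v \<longleftrightarrow> 1 *\<^sub>R v = s\<^sup>2 *\<^sub>R v"
      by simp
    also have "\<dots> \<longleftrightarrow> s = 1"
      using that unfolding scaleR_cancel_right by (auto simp: power2_eq_1_iff)
    finally show ?thesis .
  qed
  moreover have "\<exists>v :: real^'n. v \<noteq> 0"
    by (metis zero_neq_one)
  ultimately show ?thesis
    unfolding singular_values_def assms by auto
qed

section \<open>Quadratic functions\<close>

lemma convex_combination_norm_sq: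
  fixes x y :: "'a::real_inner"
  shows "(norm ((1 - t) *\<^sub>R x + t *\<^sub>R y))\<^sup>2 =
    (1 - t) * (norm x)\<^sup>2 + t * (norm y)\<^sup>2 - t * (1 - t) * (norm (x - y))\<^sup>2"
  unfolding power2_norm_eq_inner
  by (simp add: inner_add_left inner_add_right inner_diff_left inner_diff_right inner_commute
      algebra_simps)

text \<open>The case \<open>\<beta> = 0\<close>, the zero function, serves as \<open>g\<close> when
  \<open>0 \<le> \<epsilon>\<close>.\<close>

definition quad_fun :: "real \<Rightarrow> 'a::real_inner \<Rightarrow> ereal" where
  "quad_fun \<beta> x = ereal (\<beta> / 2 * (norm x)\<^sup>2)"

lemma ereal_convex_quad_fun:
  assumes "0 \<le> \<beta>"
  shows "ereal_convex (quad_fun \<beta>)"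
proof -
  have "\<beta> / 2 * (norm ((1 - t) *\<^sub>R x + t *\<^sub>R y))\<^sup>2 \<le>
      (1 - t) * (\<beta> / 2 * (norm x)\<^sup>2) + t * (\<beta> / 2 * (norm y)\<^sup>2)"
    if "t \<in> {0..1}" for t and x y :: 'a
  proof -
    have "0 \<le> t * (1 - t) * (norm (x - y))\<^sup>2"
      using that by simp
    then have "(norm ((1 - t) *\<^sub>R x + t *\<^sub>R y))\<^sup>2 \<le> (1 - t) * (norm x)\<^sup>2 + t * (norm y)\<^sup>2"
      unfolding convex_combination_norm_sq by simp
    then have "\<beta> / 2 * (norm ((1 - t) *\<^sub>R x + t *\<^sub>R y))\<^sup>2 \<le>
        \<beta> / 2 * ((1 - t) * (norm x)\<^sup>2 + t * (norm y)\<^sup>2)"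
      using assms by (intro mult_left_mono) auto
    then show ?thesis
      by (simp add: distrib_left mult.left_commute)
  qed
  then show ?thesis
    by (simp add: ereal_convex_def quad_fun_def)
qed

lemma closed_fun_quad_fun: "closed_fun (quad_fun \<beta>)"
  unfolding closed_fun_def quad_fun_def ereal_less_eq
  by (auto intro!: closed_Collect_le continuous_intros)

lemma proper_fun_quad_fun: "proper_fun (quad_fun \<beta>)"
  by (simp add: proper_fun_def quad_fun_def)

lemma quad_fun_in_S_smooth:
  fixes m \<beta> L :: real
  assumes "0 \<le> m" "m \<le> \<beta>" "\<beta> \<le> L"
  shows "(quad_fun \<beta> :: 'a::euclidean_space \<Rightarrow> ereal) \<in> S_smooth m L"
proof -
  have "GDERIV (\<lambda>y. real_of_ereal (quad_fun \<beta> y)) x :> \<beta> *\<^sub>R x" for x :: 'a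
    unfolding gderiv_def quad_fun_def power2_norm_eq_inner
    by (auto intro!: derivative_eq_intros simp: inner_commute)
  moreover have "quad_fun \<beta> x \<ge>
      quad_fun \<beta> y + ereal ((\<beta> *\<^sub>R y) \<bullet> (x - y) + m / 2 * (norm (x - y))\<^sup>2)" for x y :: 'a
  proof -
    \<comment> \<open>The second-order Taylor expansion of a quadratic is exact; its curvature
      \<open>\<beta>\<close> is then lowered to \<open>m\<close>.\<close>
    have "\<beta> / 2 * (norm x)\<^sup>2 =
        \<beta> / 2 * (norm y)\<^sup>2 + (\<beta> *\<^sub>R y) \<bullet> (x - y) + \<beta> / 2 * (norm (x - y))\<^sup>2"
      unfolding power2_norm_eq_inner
      by (simp add: inner_diff_left inner_diff_right inner_commute algebra_simps)
    moreover have "m / 2 * (norm (x - y))\<^sup>2 \<le> \<beta> / 2 * (norm (x - y))\<^sup>2"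
      using assms by (intro mult_right_mono) auto
    ultimately show ?thesis
      by (simp add: quad_fun_def)
  qed
  moreover have "lipschitz_on L UNIV (\<lambda>x::'a. \<beta> *\<^sub>R x)"
    using assms by (intro lipschitz_onI)
      (auto simp: dist_norm scaleR_diff_right[symmetric] intro: mult_right_mono)
  ultimately show ?thesis
    using assms ereal_convex_quad_fun[of \<beta>, where 'a = 'a]
    unfolding S_smooth_def
    by (intro CollectI conjI exI[of _ "\<lambda>x. \<beta> *\<^sub>R x"]) (auto simp: quad_fun_def)
qed

section \<open>The x-update for a quadratic\<close>

text \<open>The point \<open>s\<close> is the zero of the gradient
  \<open>\<beta> s + \<rho> (s + w)\<close>, and completing the square makes the gap to any
  \<open>y\<close> a nonnegative multiple of the squared distance from \<open>s\<close>.\<close>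

lemma prox_quad_minimum:
  fixes w y :: "'a::real_inner"
  assumes "0 < \<beta>" "0 < \<rho>"
  defines "s \<equiv> - (\<rho> / (\<beta> + \<rho>)) *\<^sub>R w"
  shows "\<beta> / 2 * (norm s)\<^sup>2 + \<rho> / 2 * (norm (s + w))\<^sup>2 \<le>
    \<beta> / 2 * (norm y)\<^sup>2 + \<rho> / 2 * (norm (y + w))\<^sup>2"
proof -
  have w: "(\<beta> + \<rho>) *\<^sub>R s = - (\<rho> *\<^sub>R w)"
    using assms(1,2) by (simp add: s_def)
  have "(\<beta> + \<rho>) * (s \<bullet> v) = - (\<rho> * (w \<bullet> v))" for v
    using arg_cong[OF w, of "\<lambda>a. a \<bullet> v"] by simp
  \<comment> \<open>Pairing stationarity with \<open>y\<close> and with \<open>s\<close> eliminates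
    the inner products with \<open>w\<close> from the expanded gap.\<close>
  from this[of y] this[of s]
  have "\<beta> / 2 * (norm y)\<^sup>2 + \<rho> / 2 * (norm (y + w))\<^sup>2 -
      (\<beta> / 2 * (norm s)\<^sup>2 + \<rho> / 2 * (norm (s + w))\<^sup>2) = (\<beta> + \<rho>) / 2 * (norm (y - s))\<^sup>2"
    unfolding power2_norm_eq_inner
    by (simp add: inner_add_left inner_add_right inner_diff_left inner_diff_right inner_commute
      field_simps)
  moreover have "0 \<le> (\<beta> + \<rho>) / 2 * (norm (y - s))\<^sup>2"
    using assms by simp
  ultimately show ?thesis
    by linarith
qed

text \<open>An isometry allows \<open>\<xi>\<close> to be replaced by \<open>A *v \<xi>\<close> in
  the quadratic as well, which reduces the update to the proximal problem above.\<close>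

lemma is_arg_min_quad_fun:
  fixes A :: "real^'p::finite^'r::finite"
  assumes "transpose A ** A = mat 1" "0 < \<beta>" "0 < \<rho>"
    and "A *v x = - (\<rho> / (\<beta> + \<rho>)) *\<^sub>R w"
  shows "is_arg_min (\<lambda>\<xi>. quad_fun \<beta> \<xi> + ereal (\<rho> / 2 * (norm (A *v \<xi> + w))\<^sup>2)) (\<lambda>_. True) x"
proof -
  have "\<beta> / 2 * (norm x)\<^sup>2 + \<rho> / 2 * (norm (A *v x + w))\<^sup>2 \<le>
      \<beta> / 2 * (norm y)\<^sup>2 + \<rho> / 2 * (norm (A *v y + w))\<^sup>2" for y
    using prox_quad_minimum[OF assms(2,3), of w "A *v y"]
    unfolding assms(4)[symmetric] norm_isometry_mult[OF assms(1)] .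
  then show ?thesis
    by (simp only: is_arg_min_def quad_fun_def not_less plus_ereal.simps ereal_less_eq simp_thms
        not_ex)
qed

section \<open>Lower bounds on the rate of a single run\<close>

text \<open>Nothing about the fixed point is needed: a bound \<open>C * \<tau> ^ k\<close> with \<open>\<tau> < \<mu>\<close> forces it to be
  the limit \<open>0\<close> of the iterates.\<close>

lemma admm_rate_lower_bound:
  assumes lim: "0 < \<mu> \<Longrightarrow> w \<longlonglongrightarrow> 0" and low: "\<And>k. \<mu> ^ k \<le> norm (w k)" and "\<mu> < 1"
  shows "ereal \<mu> \<le> admm_rate f g A B c \<rho> \<alpha> w"
  unfolding admm_rate_def
proof (rule Inf_greatest, clarsimp)
  fix \<tau> x z u C
  assume \<tau>: "0 \<le> \<tau>" and C: "\<forall>k. norm (w k - (x, z, u)) \<le> C * \<tau> ^ k"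
  show "\<mu> \<le> \<tau>"
  proof (rule ccontr)
    \<comment> \<open>For large \<open>\<alpha>\<close> the factor \<open>\<mu>\<close> may be
      negative. As \<open>\<tau>\<close> is nonnegative, a counterexample forces
      \<open>\<mu>\<close> to be positive, so the conditional \<open>lim\<close> applies.\<close>
    assume "\<not> \<mu> \<le> \<tau>"
    with \<tau> have \<mu>: "0 < \<mu>" "\<tau> < \<mu>" by auto
    have "(\<lambda>k. C * \<tau> ^ k) \<longlonglongrightarrow> C * 0"
      using \<tau> \<mu> \<open>\<mu> < 1\<close> by (intro tendsto_intros LIMSEQ_realpow_zero) auto
    then have "(\<lambda>k. w k - (x, z, u)) \<longlonglongrightarrow> 0"
      using Lim_null_comparison[OF always_eventually[OF C]] by simp
    then have "w \<longlonglongrightarrow> (x, z, u)"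
      by (simp only: LIM_zero_iff)
    then have "(x, z, u) = 0"
      using lim[OF \<mu>(1)] LIMSEQ_unique by blast
    then have "\<mu> ^ k \<le> C * \<tau> ^ k" for k
      using C low[of k] by (metis diff_zero order_trans)
    \<comment> \<open>After division by \<open>\<mu> ^ k\<close> the right-hand side is geometric
      with ratio below 1, so it cannot stay above 1.\<close>
    then have "1 \<le> C * (\<tau> / \<mu>) ^ k" for k
      using \<mu> by (simp add: power_divide pos_le_divide_eq)
    moreover have "(\<lambda>k. C * (\<tau> / \<mu>) ^ k) \<longlonglongrightarrow> C * 0"
      using \<tau> \<mu> by (intro tendsto_intros LIMSEQ_realpow_zero) auto
    ultimately have "1 \<le> C * 0"
      by (meson LIMSEQ_le_const)
    then show False by simp
  qed
qed

section \<open>Two explicit geometric runs\<close>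

lemma pow_pred_scaleR_tendsto_0:
  fixes v :: "'a::real_normed_vector"
  assumes "0 < \<mu>" "\<mu> < 1"
  shows "(\<lambda>k. (a * \<mu> ^ (k - 1)) *\<^sub>R v) \<longlonglongrightarrow> 0"
proof -
  have "(\<lambda>k. (a * \<mu> ^ (Suc k - 1)) *\<^sub>R v) \<longlonglongrightarrow> (a * 0) *\<^sub>R v"
    using assms by (simp only: diff_Suc_1) (intro tendsto_intros LIMSEQ_realpow_zero, auto)
  then show ?thesis
    using filterlim_sequentially_Suc[of "\<lambda>k. (a * \<mu> ^ (k - 1)) *\<^sub>R v"] by simp
qed

lemma pow_scaleR_tendsto_0:
  fixes v :: "'a::real_normed_vector"
  assumes "0 < \<mu>" "\<mu> < 1"
  shows "(\<lambda>k. (\<mu> ^ k) *\<^sub>R v) \<longlonglongrightarrow> 0"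
proof -
  have "(\<lambda>k. (\<mu> ^ k) *\<^sub>R v) \<longlonglongrightarrow> 0 *\<^sub>R v"
    using assms by (intro tendsto_intros LIMSEQ_realpow_zero) auto
  then show ?thesis by simp
qed

text \<open>In both runs the truncated exponent \<open>k - 1\<close> only fixes the irrelevant initial \<open>x\<close> and avoids a
  division by \<open>\<mu>\<close>, which may vanish.\<close>

lemma zero_regularizer_run:
  fixes A :: "real^'p::finite^'r::finite" and B :: "real^'q::finite^'r" and \<alpha> :: real
  assumes A: "transpose A ** A = mat 1" and "0 < \<beta>" "0 < \<rho>" and a: "A *v a = B *v v"
  defines "\<mu> \<equiv> 1 - \<alpha> * (\<beta> / (\<beta> + \<rho>))"
  shows "admm_run (quad_fun \<beta>) (quad_fun 0) A B 0 \<rho> \<alpha>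
    (\<lambda>k. ((- (\<rho> / (\<beta> + \<rho>)) * \<mu> ^ (k - 1)) *\<^sub>R a, \<mu> ^ k *\<^sub>R v, 0))"
  unfolding admm_run_def
proof
  fix k
  define x where "x = (- (\<rho> / (\<beta> + \<rho>)) * \<mu> ^ k) *\<^sub>R a"
  have Ax: "A *v x = - (\<rho> / (\<beta> + \<rho>)) *\<^sub>R (B *v (\<mu> ^ k *\<^sub>R v))"
    unfolding x_def matrix_vector_mult_scaleR a by simp
  \<comment> \<open>In this form \<open>\<mu>\<close> is the coefficient in
    \<open>\<alpha> A x - (1 - \<alpha>) B z = - \<mu> B z\<close>, obtained by inserting
    \<open>Ax\<close>.\<close>
  have \<mu>: "\<mu> = (1 - \<alpha>) + \<alpha> * (\<rho> / (\<beta> + \<rho>))"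
    using assms by (simp add: \<mu>_def field_simps)
  \<comment> \<open>The vanishing residual serves twice: the new \<open>z\<close> brings the penalty
    to its least value 0, and \<open>u\<close> stays at 0.\<close>
  have r: "\<alpha> *\<^sub>R (A *v x) - (1 - \<alpha>) *\<^sub>R (B *v (\<mu> ^ k *\<^sub>R v)) + B *v (\<mu> ^ Suc k *\<^sub>R v) = 0"
    unfolding Ax matrix_vector_mult_scaleR power_Suc
    \<comment> \<open>Only the leading factor of \<open>\<mu> ^ Suc k\<close> is expanded; the
      powers \<open>\<mu> ^ k\<close> remain as a common factor.\<close>
    by (subst (3) \<mu>) (simp add: algebra_simps)
  show "admm_step (quad_fun \<beta>) (quad_fun 0) A B 0 \<rho> \<alpha>
      ((- (\<rho> / (\<beta> + \<rho>)) * \<mu> ^ (k - 1)) *\<^sub>R a, \<mu> ^ k *\<^sub>R v, 0)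
      ((- (\<rho> / (\<beta> + \<rho>)) * \<mu> ^ (Suc k - 1)) *\<^sub>R a, \<mu> ^ Suc k *\<^sub>R v, 0)"
    unfolding diff_Suc_1 x_def[symmetric] admm_step.simps
  proof (intro conjI)
    show "is_arg_min (\<lambda>\<xi>. quad_fun \<beta> \<xi> +
        ereal (\<rho> / 2 * (norm (A *v \<xi> + B *v (\<mu> ^ k *\<^sub>R v) - 0 + 0))\<^sup>2)) (\<lambda>_. True) x"
      using is_arg_min_quad_fun[OF A \<open>0 < \<beta>\<close> \<open>0 < \<rho>\<close> Ax] by simp
    show "is_arg_min (\<lambda>\<zeta>. quad_fun 0 \<zeta> +
        ereal (\<rho> / 2 * (norm (\<alpha> *\<^sub>R (A *v x) - (1 - \<alpha>) *\<^sub>R (B *v (\<mu> ^ k *\<^sub>R v)) +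
          B *v \<zeta> - \<alpha> *\<^sub>R 0 + 0))\<^sup>2)) (\<lambda>_. True) (\<mu> ^ Suc k *\<^sub>R v)"
      using r \<open>0 < \<rho>\<close> by (simp add: is_arg_min_def quad_fun_def not_less del: power_Suc)
  qed (use r in \<open>simp del: power_Suc\<close>)
qed

definition origin_indicator :: "'a::zero \<Rightarrow> ereal" where
  "origin_indicator x = (if x = 0 then 0 else \<infinity>)"

lemma ereal_convex_origin_indicator: "ereal_convex (origin_indicator :: 'a::real_vector \<Rightarrow> ereal)"
proof -
  have "origin_indicator ((1 - t) *\<^sub>R x + t *\<^sub>R y) \<le>
      ereal (1 - t) * origin_indicator x + ereal t * origin_indicator y"
    if t: "t \<in> {0..1}" for t :: real and x y :: 'a
  proof -
    \<comment> \<open>At the endpoints the convention that 0 times infinity is 0 leaves one summand.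
      In between, the right-hand side is infinite unless \<open>x\<close> and \<open>y\<close> are
      both 0.\<close>
    consider "t = 0" | "t = 1" | "0 < t" "t < 1"
      using t by fastforce
    then show ?thesis
      by cases (auto simp: origin_indicator_def zero_ereal_def[symmetric] one_ereal_def[symmetric])
  qed
  then show ?thesis
    by (simp add: ereal_convex_def origin_indicator_def)
qed

lemma closed_fun_origin_indicator: "closed_fun (origin_indicator :: 'a::{t1_space,zero} \<Rightarrow> ereal)"
proof -
  have "{x::'a. origin_indicator x \<le> ereal a} = (if 0 \<le> a then {0} else {})" for a
    by (auto simp: origin_indicator_def split: if_splits)
  then show ?thesis
    by (simp add: closed_fun_def)
qed

lemma proper_fun_origin_indicator: "proper_fun origin_indicator"
  by (auto simp: proper_fun_def origin_indicator_def)

lemma origin_indicator_run: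
  fixes A :: "real^'p::finite^'r::finite" and B :: "real^'q::finite^'r" and \<alpha> :: real
  assumes A: "transpose A ** A = mat 1" and "0 < \<beta>" "0 < \<rho>" and a: "A *v a = b"
  defines "\<mu> \<equiv> 1 - \<alpha> * (\<rho> / (\<beta> + \<rho>))"
  shows "admm_run (quad_fun \<beta>) origin_indicator A B 0 \<rho> \<alpha>
    (\<lambda>k. ((- (\<rho> / (\<beta> + \<rho>)) * \<mu> ^ (k - 1)) *\<^sub>R a, 0, \<mu> ^ k *\<^sub>R b))"
  unfolding admm_run_def
proof
  fix k
  define x where "x = (- (\<rho> / (\<beta> + \<rho>)) * \<mu> ^ k) *\<^sub>R a"
  have Ax: "A *v x = - (\<rho> / (\<beta> + \<rho>)) *\<^sub>R (\<mu> ^ k *\<^sub>R b)"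
    unfolding x_def matrix_vector_mult_scaleR a by simp
  \<comment> \<open>With \<open>z\<close> pinned at 0 the multiplier update is just
    \<open>u + \<alpha> A x\<close>, and \<open>Ax\<close> makes \<open>A x\<close> a multiple of
    \<open>u\<close>.\<close>
  have r: "\<mu> ^ Suc k *\<^sub>R b = \<mu> ^ k *\<^sub>R b + \<alpha> *\<^sub>R (A *v x)"
    unfolding Ax power_Suc by (subst (1) \<mu>_def) (simp add: algebra_simps)
  show "admm_step (quad_fun \<beta>) origin_indicator A B 0 \<rho> \<alpha>
      ((- (\<rho> / (\<beta> + \<rho>)) * \<mu> ^ (k - 1)) *\<^sub>R a, 0, \<mu> ^ k *\<^sub>R b)
      ((- (\<rho> / (\<beta> + \<rho>)) * \<mu> ^ (Suc k - 1)) *\<^sub>R a, 0, \<mu> ^ Suc k *\<^sub>R b)"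
    unfolding diff_Suc_1 x_def[symmetric] admm_step.simps
    using is_arg_min_quad_fun[OF A \<open>0 < \<beta>\<close> \<open>0 < \<rho>\<close> Ax]
    by (auto simp: is_arg_min_def origin_indicator_def r simp del: power_Suc)
qed

section \<open>The worst-case bound\<close>

theorem theorem8:
  fixes \<kappa> \<epsilon> \<alpha> :: real
  assumes "CARD('p::finite) = CARD('r::finite)" and "CARD('q::finite) \<le> CARD('r)"
    and "1 \<le> \<kappa>" and "0 < \<alpha>"
  shows "worst_case_rate TYPE('p) TYPE('q) TYPE('r) \<kappa> \<epsilon> \<alpha>
           \<ge> ereal (1 - 2 * \<alpha> / (1 + \<kappa> powr (0.5 + \<bar>\<epsilon>\<bar>)))"
proof -
  \<comment> \<open>The bijection makes \<open>A\<close> orthogonal, hence invertible; the injection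
    makes \<open>B\<close> an isometry, hence of full column rank.\<close>
  obtain h :: "'p \<Rightarrow> 'r" where "bij h"
    using assms(1) finite_same_card_bij[of "UNIV :: 'p set" "UNIV :: 'r set"] by auto
  obtain j :: "'q \<Rightarrow> 'r" where "inj j"
    using assms(2) card_le_inj[of "UNIV :: 'q set" "UNIV :: 'r set"] by auto
  define A where "A = inj_matrix h"
  define B where "B = inj_matrix j"
  have A: "transpose A ** A = mat 1" "A ** transpose A = mat 1"
    using \<open>bij h\<close> by (auto simp: A_def transpose_inj_matrix_mult inj_matrix_mult_transpose bij_is_inj)
  have B: "transpose B ** B = mat 1"
    using \<open>inj j\<close> by (simp add: B_def transpose_inj_matrix_mult)
  have "invertible A"
    using A by (auto simp: invertible_def)
  \<comment> \<open>Unit length makes the norm of the nonzero \<open>z\<close> or \<open>u\<close>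
    component exactly \<open>\<bar>\<mu>\<bar> ^ k\<close>, with no extra constant.\<close>
  obtain v :: "real^'q" where v: "norm v = 1"
    using vector_choose_size[of 1] by auto
  define b where "b = B *v v"
  have b: "norm b = 1"
    by (simp add: b_def norm_isometry_mult[OF B] v)
  \<comment> \<open>The preimage of \<open>b\<close> under the orthogonal \<open>A\<close>: the
    direction of \<open>x\<close> in both runs.\<close>
  define a where "a = transpose A *v b"
  have a: "A *v a = b"
    by (simp only: a_def matrix_vector_mul_assoc A matrix_vector_mul_lid)
  \<comment> \<open>The prescribed step size for \<open>m = 1\<close>, \<open>L = \<kappa>\<close>
    and all singular values of \<open>A\<close> equal to 1.\<close>
  define \<rho> where "\<rho> = \<kappa> powr (1/2 + \<epsilon>)"
  have "0 < \<rho>"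
    using assms(3) by (simp add: \<rho>_def)
  have step: "step_size 1 \<kappa> A \<epsilon> = \<rho>" and cond: "cond_total 1 \<kappa> A = \<kappa>"
    using singular_values_isometry[OF A(1)]
    by (simp_all add: step_size_def cond_total_def m_hat_def L_hat_def sigma_max_def sigma_min_def
        \<rho>_def powr_add)
  have f: "admm_assumptions 1 \<kappa> (quad_fun \<beta>) g A B"
    if "1 \<le> \<beta>" "\<beta> \<le> \<kappa>" "ereal_convex g" "closed_fun g" "proper_fun g" for \<beta> g
    using that assms(3) \<open>invertible A\<close> rank_isometry[OF B]
    by (simp add: admm_assumptions_def ereal_convex_quad_fun closed_fun_quad_fun
        proper_fun_quad_fun quad_fun_in_S_smooth S_convex_def)
  \<comment> \<open>A common form of both factors:
    \<open>\<kappa> powr (0.5 + \<bar>\<epsilon>\<bar>)\<close> is \<open>\<rho>\<close> for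
    \<open>0 \<le> \<epsilon>\<close> and \<open>\<kappa> / \<rho>\<close> for negative
    \<open>\<epsilon>\<close>.\<close>
  define \<mu> where "\<mu> = 1 - \<alpha> * (1 / (1 + \<kappa> powr (0.5 + \<bar>\<epsilon>\<bar>)))"
  have pos: "0 < 1 + \<kappa> powr (0.5 + \<bar>\<epsilon>\<bar>)"
    by (simp add: add_pos_nonneg)
  have "\<mu> < 1"
    using assms(4) pos by (simp add: \<mu>_def)
  \<comment> \<open>Shared by both cases: one admissible instance and run with factor
    \<open>\<mu>\<close> bounds the supremum from below.\<close>
  have *: "ereal \<mu> \<le> worst_case_rate TYPE('p) TYPE('q) TYPE('r) \<kappa> \<epsilon> \<alpha>"
    if "admm_assumptions 1 \<kappa> f g A B" "admm_run f g A B 0 \<rho> \<alpha> w"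
      "0 < \<mu> \<Longrightarrow> w \<longlonglongrightarrow> 0" "\<And>k. \<mu> ^ k \<le> norm (w k)" for f g w
  proof -
    have "admm_rate f g A B 0 \<rho> \<alpha> w \<le> worst_case_rate TYPE('p) TYPE('q) TYPE('r) \<kappa> \<epsilon> \<alpha>"
      unfolding worst_case_rate_def using that(1,2) step cond by (intro Sup_upper) force
    with admm_rate_lower_bound[OF that(3,4) \<open>\<mu> < 1\<close>] show ?thesis
      by (rule order_trans)
  qed
  have "ereal \<mu> \<le> worst_case_rate TYPE('p) TYPE('q) TYPE('r) \<kappa> \<epsilon> \<alpha>"
  proof (cases "0 \<le> \<epsilon>")
    case True
    then have \<mu>: "\<mu> = 1 - \<alpha> * (1 / (1 + \<rho>))"
      by (simp add: \<mu>_def \<rho>_def)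
    let ?w = "\<lambda>k. ((- (\<rho> / (1 + \<rho>)) * \<mu> ^ (k - 1)) *\<^sub>R a, \<mu> ^ k *\<^sub>R v, 0 :: real^'r)"
    show ?thesis
    proof (rule *)
      show "admm_assumptions 1 \<kappa> (quad_fun 1) (quad_fun 0) A B"
        using f[of 1 "quad_fun 0"] assms(3)
        by (simp add: ereal_convex_quad_fun closed_fun_quad_fun proper_fun_quad_fun)
      show "admm_run (quad_fun 1) (quad_fun 0) A B 0 \<rho> \<alpha> ?w"
        using zero_regularizer_run[OF A(1) zero_less_one \<open>0 < \<rho>\<close>, of a B v \<alpha>] a
        by (simp only: \<mu> b_def)
      show "?w \<longlonglongrightarrow> 0" if "0 < \<mu>"
        unfolding zero_prod_def using that \<open>\<mu> < 1\<close>
        by (intro tendsto_Pair pow_pred_scaleR_tendsto_0 pow_scaleR_tendsto_0 tendsto_const)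
      show "\<mu> ^ k \<le> norm (?w k)" for k
      proof -
        \<comment> \<open>This covers negative \<open>\<mu>\<close> too, since a power is at most
          its absolute value.\<close>
        have "\<mu> ^ k \<le> norm (\<mu> ^ k *\<^sub>R v)"
          by (simp add: v)
        also have "\<dots> \<le> norm (?w k)"
          by (meson norm_fst_le norm_snd_le order_trans)
        finally show ?thesis .
      qed
    qed
  next
    case False
    \<comment> \<open>The exponent is \<open>1 - (1/2 + \<epsilon>) = 1/2 - \<epsilon>\<close>, and
      \<open>- \<epsilon> = \<bar>\<epsilon>\<bar>\<close> here.\<close>
    have "\<kappa> / \<rho> = \<kappa> powr (0.5 + \<bar>\<epsilon>\<bar>)"
      using False assms(3) powr_diff[of \<kappa> 1 "1/2 + \<epsilon>"] by (simp add: \<rho>_def)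
    moreover have "1 / (1 + \<kappa> / \<rho>) = \<rho> / (\<kappa> + \<rho>)"
      using \<open>0 < \<rho>\<close> assms(3) by (simp add: field_simps)
    ultimately have \<mu>: "\<mu> = 1 - \<alpha> * (\<rho> / (\<kappa> + \<rho>))"
      by (simp add: \<mu>_def)
    let ?w = "\<lambda>k. ((- (\<rho> / (\<kappa> + \<rho>)) * \<mu> ^ (k - 1)) *\<^sub>R a, 0 :: real^'q, \<mu> ^ k *\<^sub>R b)"
    show ?thesis
    proof (rule *)
      show "admm_assumptions 1 \<kappa> (quad_fun \<kappa>) origin_indicator A B"
        using f assms(3) ereal_convex_origin_indicator closed_fun_origin_indicator
          proper_fun_origin_indicator by blast
      show "admm_run (quad_fun \<kappa>) origin_indicator A B 0 \<rho> \<alpha> ?w"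
        using origin_indicator_run[OF A(1) _ \<open>0 < \<rho>\<close> a, of \<kappa> B \<alpha>] assms(3)
        by (simp add: \<mu>)
      show "?w \<longlonglongrightarrow> 0" if "0 < \<mu>"
        unfolding zero_prod_def using that \<open>\<mu> < 1\<close>
        by (intro tendsto_Pair pow_pred_scaleR_tendsto_0 pow_scaleR_tendsto_0 tendsto_const)
      show "\<mu> ^ k \<le> norm (?w k)" for k
      proof -
        have "\<mu> ^ k \<le> norm (\<mu> ^ k *\<^sub>R b)"
          by (simp add: b)
        also have "\<dots> \<le> norm (?w k)"
          by (meson norm_snd_le order_trans)
        finally show ?thesis .
      qed
    qed
  qed
  moreover have "1 - 2 * \<alpha> / (1 + \<kappa> powr (0.5 + \<bar>\<epsilon>\<bar>)) \<le> \<mu>"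
    using assms(4) pos by (simp add: \<mu>_def divide_right_mono)
  ultimately show ?thesis
    by (meson ereal_less_eq(3) order_trans)
qed

end
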